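(* Let $q$ be a prime power, $n\ge 2$, and let $U\subsetneq \mathbb{F}_{q^n}$ be an $\mathbb{F}_q$-vector space of dimension $d_U\ge 1$. If $U$ does not contain a nonzero square of $\mathbb{F}_{q^n}$, then $\omega(G_U)\le d_U+2$. Assume now that $\omega(G_U)>d_U+2$ and let $D_U$, with $1\le D_U\le d_U$, be the greatest divisor of $n$ such that $a^2\mathbb{F}_{q^{D_U}}\subseteq U$ for some $a\in\mathbb{F}_{q^n}$, $a\neq 0$. Then $\omega(G_U)=q^t+r$ for some integers $t,r\ge 0$ such that $r+t\le d_U$ and $$1\le t\le \kappa_U:=\max\left\{D_U,\ \frac{7}{8}d_U+\frac{7}{32\log_2 q}\right\}.$$ In particular, $q^{D_U}\le \omega(G_U)\le q^{\kappa_U}+d_U$.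
   Context: $\mathbb{F}_{q^n}$ is regarded as an $n$-dimensional vector space over $\mathbb{F}_q$, and $\mathbb{F}_{q^{D}}$ (for $D\mid n$) denotes the unique subfield of $\mathbb{F}_{q^n}$ with $q^D$ elements. For an $\mathbb{F}_q$-vector subspace $U\subsetneq \mathbb{F}_{q^n}$, $G_U$ is the undirected graph with vertex set $\mathbb{F}_{q^n}$ in which distinct $a,b$ are adjacent if and only if $ab\in U$; $d_U$ is the $\mathbb{F}_q$-dimension of $U$ and $\omega(G_U)$ is the clique number of $G_U$. A nonzero square means an element $b^2$ with $b\in\mathbb{F}_{q^n}^*$. *)

theory Defs
  imports Complex_Main "HOL-Library.Cardinality" "HOL-Number_Theory.Prime_Powers"
begin

text \<open>
  The extension of the field with \<open>q\<close> elements by the field with \<open>q ^ n\<close> elements is rendered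
  by two finite field types \<open>'k\<close> and \<open>'a\<close> and an arbitrary unital ring homomorphism between them.
\<close>

locale field_extension =
  fixes emb :: "'k::field \<Rightarrow> 'a::field"
  assumes emb_add: "emb (x + y) = emb x + emb y"
    and emb_mult: "emb (x * y) = emb x * emb y"
    and emb_one: "emb 1 = 1"

definition ext_scale :: "('k::field \<Rightarrow> 'a::field) \<Rightarrow> 'k \<Rightarrow> 'a \<Rightarrow> 'a" where
  "ext_scale emb c x = emb c * x"

lemma (in field_extension) vector_space_ext_scale: "vector_space (ext_scale emb)"
  by unfold_locales (simp_all add: ext_scale_def emb_add emb_mult emb_one algebra_simps)

definition is_subfield :: "'a::field set \<Rightarrow> bool" where
  "is_subfield S \<longleftrightarrow> 0 \<in> S \<and> 1 \<in> S \<and>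
     (\<forall>x\<in>S. \<forall>y\<in>S. x + y \<in> S \<and> x * y \<in> S) \<and>
     (\<forall>x\<in>S. - x \<in> S \<and> inverse x \<in> S)"

text \<open>Meaningful for \<open>m = q ^ D\<close> with \<open>D dvd n\<close> inside a field with \<open>q ^ n\<close> elements,
  where such a subfield exists and is unique.\<close>

definition subfield_of_card :: "nat \<Rightarrow> 'a::{field,finite} set" where
  "subfield_of_card m = (THE S. is_subfield S \<and> card S = m)"

text \<open>A simple undirected graph is a pair of its vertex set and its set of two-element edges.\<close>

type_synonym 'v graph = "'v set \<times> 'v set set"

definition is_clique :: "'v graph \<Rightarrow> 'v set \<Rightarrow> bool" where
  "is_clique G C \<longleftrightarrow> C \<subseteq> fst G \<and> (\<forall>a\<in>C. \<forall>b\<in>C. a \<noteq> b \<longrightarrow> {a, b} \<in> snd G)"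

definition clique_number :: "'v graph \<Rightarrow> nat" where
  "clique_number G = Max (card ` {C. is_clique G C})"

definition product_graph :: "'a::{field,finite} set \<Rightarrow> 'a graph" where
  "product_graph U = (UNIV, {{a, b} |a b. a \<noteq> b \<and> a * b \<in> U})"

definition square_subfield_divisor :: "nat \<Rightarrow> nat \<Rightarrow> 'a::{field,finite} set \<Rightarrow> nat \<Rightarrow> bool" where
  "square_subfield_divisor q n U D \<longleftrightarrow>
     D dvd n \<and> (\<exists>a. a \<noteq> 0 \<and> (\<lambda>x. a\<^sup>2 * x) ` subfield_of_card (q ^ D) \<subseteq> U)"

definition greatest_divisor :: "nat \<Rightarrow> nat \<Rightarrow> 'a::{field,finite} set \<Rightarrow> nat" where
  "greatest_divisor q n U = (GREATEST D. square_subfield_divisor q n U D)"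

definition kappa :: "nat \<Rightarrow> nat \<Rightarrow> nat \<Rightarrow> real" where
  "kappa q d D = max (real D) (7 / 8 * real d + 7 / (32 * log 2 (real q)))"

end

theory Submission
  imports Defs "HOL-Computational_Algebra.Polynomial"
begin

text \<open>
  In a maximum clique the elements whose square lies in \<open>U\<close> may be replaced by their span \<open>V\<close>,
  and the remaining elements \<open>B\<close> are linearly independent modulo \<open>V\<close>: if \<open>b\<close> were a combination
  of the others, then \<open>b\<^sup>2 \<in> U\<close>. So the clique number is \<open>q ^ t + r\<close> with \<open>t = dim V\<close> and
  \<open>r = card B\<close>; multiplication by a nonzero element of \<open>V\<close> maps \<open>V\<close> and \<open>B\<close> into \<open>U\<close>, whence
  \<open>r + t \<le> d\<close>, while \<open>V = {0}\<close> forces \<open>r \<le> d + 1\<close>.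

  The bound on \<open>t\<close> holds with \<open>2 d / 3\<close> in place of \<open>7 d / 8\<close>. If \<open>2 d < 3 t\<close>, then for \<open>x\<close> in the
  set \<open>H\<close> of quotients of elements of \<open>V\<close> the space \<open>V \<inter> x V\<close> has dimension above \<open>t / 2\<close>.
  Two such subspaces of \<open>V\<close> meet nontrivially, so any two elements of \<open>H\<close> have a common
  denominator, and \<open>H\<close> is a subfield. Moreover \<open>card H < (card V)\<^sup>2\<close>, and duality inside \<open>H\<close>
  gives \<open>v\<^sup>2 H \<subseteq> U\<close> for nonzero \<open>v \<in> V\<close>, so that \<open>t \<le> D\<close>.
\<close>

section \<open>Products of additive subgroups of a finite field\<close>

text \<open>Additive subgroups. The counting below uses only the group structure, so scalars enter
  only after the subfield has been found.\<close>

definition diff_closed :: "'a::ab_group_add set \<Rightarrow> bool" where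
  "diff_closed A \<longleftrightarrow> 0 \<in> A \<and> (\<forall>x\<in>A. \<forall>y\<in>A. x - y \<in> A)"

lemma diff_closed_zero: "diff_closed A \<Longrightarrow> 0 \<in> A"
  and diff_closed_diff: "diff_closed A \<Longrightarrow> x \<in> A \<Longrightarrow> y \<in> A \<Longrightarrow> x - y \<in> A"
  by (auto simp: diff_closed_def)

lemma diff_closed_uminus:
  assumes "diff_closed A" "x \<in> A"
  shows "- x \<in> A"
  using diff_closed_diff[OF assms(1) diff_closed_zero[OF assms(1)] assms(2)] by simp

lemma diff_closed_add:
  assumes "diff_closed A" "x \<in> A" "y \<in> A"
  shows "x + y \<in> A"
  using diff_closed_diff[OF assms(1,2) diff_closed_uminus[OF assms(1,3)]] by simp

lemma diff_closed_mult_image: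
  fixes A :: "'a::comm_ring set"
  assumes "diff_closed A"
  shows "diff_closed ((*) c ` A)"
  unfolding diff_closed_def
proof (intro conjI ballI)
  show "0 \<in> (*) c ` A"
    using diff_closed_zero[OF assms] by (metis image_eqI mult_zero_right)
next
  fix x y assume "x \<in> (*) c ` A" "y \<in> (*) c ` A"
  then obtain a b where ab: "a \<in> A" "b \<in> A" "x = c * a" "y = c * b" by auto
  then have "x - y = c * (a - b)" by (simp add: right_diff_distrib)
  then show "x - y \<in> (*) c ` A" using ab assms by (auto intro: diff_closed_diff)
qed

lemma card_mult_image:
  fixes A :: "'a::field set"
  shows "c \<noteq> 0 \<Longrightarrow> card ((*) c ` A) = card A"
  by (simp add: card_image inj_on_def)

text \<open>The counting form of \<open>dim A + dim B \<le> dim (A \<inter> B) + dim C\<close>: no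
  fibre of the difference map from \<open>A \<times> B\<close> to \<open>C\<close> has more elements
  than \<open>A \<inter> B\<close>.\<close>

lemma card_prod_le_card_inter_mult:
  fixes A B C :: "'a::ab_group_add set"
  assumes C: "diff_closed C" "finite C" and A: "diff_closed A" "A \<subseteq> C" and B: "diff_closed B" "B \<subseteq> C"
  shows "card A * card B \<le> card (A \<inter> B) * card C"
proof -
  define S where "S c = {p \<in> A \<times> B. fst p - snd p = c}" for c
  have finA: "finite A" and finB: "finite B"
    using A B C finite_subset by blast+
  have "A \<times> B \<subseteq> (\<Union>c\<in>C. S c)"
    using A B C by (auto simp: S_def intro!: diff_closed_diff[of C])
  moreover have "finite (\<Union>c\<in>C. S c)"
    using finA finB C by (auto simp: S_def)
  ultimately have "card (A \<times> B) \<le> card (\<Union>c\<in>C. S c)" by (rule card_mono[rotated])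
  also have "\<dots> \<le> (\<Sum>c\<in>C. card (S c))"
    using C by (intro card_UN_le)
  also have "\<dots> \<le> (\<Sum>c\<in>C. card (A \<inter> B))"
  proof (rule sum_mono)
    fix c assume "c \<in> C"
    show "card (S c) \<le> card (A \<inter> B)"
    proof (cases "S c = {}")
      case False
      then obtain a0 b0 where 0: "a0 \<in> A" "b0 \<in> B" "a0 - b0 = c" by (auto simp: S_def)
      \<comment> \<open>In a fixed fibre the first component determines the second.\<close>
      have "inj_on (\<lambda>p. fst p - a0) (S c)"
        by (auto simp: inj_on_def S_def)
      moreover have "(\<lambda>p. fst p - a0) ` S c \<subseteq> A \<inter> B"
      proof clarify
        fix a b assume "(a, b) \<in> S c"
        then have ab: "a \<in> A" "b \<in> B" "a - b = c" by (auto simp: S_def)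
        then have "a - a0 = b - b0" using 0 by (metis add_diff_cancel_left diff_add_cancel)
        moreover have "a - a0 \<in> A" "b - b0 \<in> B"
          using ab 0 A(1) B(1) by (simp_all add: diff_closed_diff)
        ultimately show "fst (a, b) - a0 \<in> A \<inter> B" by simp
      qed
      ultimately show ?thesis using finA by (intro card_inj_on_le) auto
    qed simp
  qed
  finally show ?thesis by (simp add: mult.commute card_cartesian_product)
qed

lemma is_subfield_diff_closed: "is_subfield S \<Longrightarrow> diff_closed S"
  unfolding is_subfield_def diff_closed_def by (metis add_uminus_conv_diff)

text \<open>
  Replaces the nondegeneracy of a trace-like bilinear form: counting the pairs \<open>(x, v) \<in> H \<times> T\<close>
  with \<open>x v \<in> W\<close> by \<open>v\<close> and by \<open>x\<close> avoids choosing a linear functional that vanishes on \<open>W\<close>.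
\<close>

lemma card_annihilator_le:
  fixes H :: "'a::{field,finite} set"
  assumes H: "is_subfield H" and W: "diff_closed W" "W \<subset> H"
    and T: "diff_closed T" "T \<subseteq> H" and P: "P \<subseteq> H"
    and PT: "\<And>x v. x \<in> P \<Longrightarrow> v \<in> T \<Longrightarrow> x * v \<in> W"
  shows "card P * card T \<le> card H"
proof -
  have Hd: "diff_closed H" using H by (rule is_subfield_diff_closed)
  have mult: "x * y \<in> H" if "x \<in> H" "y \<in> H" for x y
    using H that by (auto simp: is_subfield_def)
  have inv: "inverse x \<in> H" if "x \<in> H" for x
    using H that by (auto simp: is_subfield_def)
  define M m t p where "M = card H" and "m = card W" and "t = card T" and "p = card P"
  have mM: "m < M" unfolding M_def m_def using W by (intro psubset_card_mono) auto
  define f where "f x = card {v \<in> T. x * v \<in> W}" for x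
  have T0: "0 \<in> T" and W0: "0 \<in> W" using T W diff_closed_zero by auto
  have pM: "p \<le> M" unfolding p_def M_def using P by (intro card_mono) auto
  have t1: "t \<ge> 1" unfolding t_def using T0 by (simp add: Suc_le_eq card_gt_0_iff) auto
  have g: "card {x \<in> H. x * v \<in> W} = (if v = 0 then M else m)" if "v \<in> T" for v
  proof (cases "v = 0")
    case False
    have "{x \<in> H. x * v \<in> W} = (*) (inverse v) ` W"
    proof (intro equalityI subsetI)
      fix x assume "x \<in> {x \<in> H. x * v \<in> W}"
      then show "x \<in> (*) (inverse v) ` W"
        using False by (intro image_eqI[of _ _ "x * v"]) auto
    next
      fix x assume "x \<in> (*) (inverse v) ` W"
      then obtain w where w: "w \<in> W" "x = inverse v * w" by auto
      from w have "x * v = w" using False by simp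
      with w have "x * v \<in> W" by (simp only:)
      moreover have "x \<in> H" using w W T that by (auto intro!: mult inv)
      ultimately show "x \<in> {x \<in> H. x * v \<in> W}" by simp
    qed
    then show ?thesis using False by (simp add: card_mult_image m_def)
  qed (simp add: W0 M_def)
  have "(\<Sum>x\<in>H. f x) = (\<Sum>x\<in>H. \<Sum>v\<in>T. if x * v \<in> W then 1 else 0)"
    unfolding f_def by (intro sum.cong) (simp_all add: sum.If_cases Int_def)
  also have "\<dots> = (\<Sum>v\<in>T. \<Sum>x\<in>H. if x * v \<in> W then 1 else 0)"
    by (rule sum.swap)
  also have "\<dots> = (\<Sum>v\<in>T. card {x \<in> H. x * v \<in> W})"
    by (intro sum.cong) (simp_all add: sum.If_cases Int_def)
  also have "\<dots> = (\<Sum>v\<in>T. if v = 0 then M else m)"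
    by (intro sum.cong) (simp_all add: g)
  also have "\<dots> = M + (t - 1) * m"
    using T0 by (simp add: sum.remove[of T 0] t_def)
  finally have total: "(\<Sum>x\<in>H. f x) = M + (t - 1) * m" .
  \<comment> \<open>For \<open>x \<noteq> 0\<close> this is the intersection bound for
    \<open>x T\<close> and \<open>W\<close>, both inside \<open>H\<close>.\<close>
  have fx: "M * f x \<ge> t * m" if "x \<in> H" for x
  proof (cases "x = 0")
    case True
    then have "f x = t" by (simp add: f_def W0 t_def)
    then show ?thesis using mM by simp
  next
    case False
    have "(*) x ` {v \<in> T. x * v \<in> W} = (*) x ` T \<inter> W" by auto
    then have "f x = card ((*) x ` T \<inter> W)"
      unfolding f_def using card_mult_image[OF False] by metis
    moreover have "card ((*) x ` T) * card W \<le> card ((*) x ` T \<inter> W) * card H"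
      using T W Hd that by (intro card_prod_le_card_inter_mult diff_closed_mult_image) (auto intro!: mult)
    ultimately show ?thesis
      using card_mult_image[OF False, of T] by (simp add: t_def m_def M_def mult.commute)
  qed
  have fP: "f x = t" if "x \<in> P" for x
  proof -
    have "{v \<in> T. x * v \<in> W} = T" using PT that by auto
    then show ?thesis by (simp add: f_def t_def)
  qed
  \<comment> \<open>Elements of \<open>P\<close> attain \<open>f x = t\<close>; the rest of
    \<open>H\<close> gets the lower bound \<open>fx\<close>.\<close>
  have "p * (M * t) + (M - p) * (t * m) = (\<Sum>x\<in>P. M * t) + (\<Sum>x\<in>H-P. t * m)"
    using P by (simp add: p_def M_def card_Diff_subset)
  also have "\<dots> \<le> (\<Sum>x\<in>P. M * f x) + (\<Sum>x\<in>H-P. M * f x)"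
    using fx P by (intro add_mono sum_mono) (auto simp: fP)
  also have "\<dots> = M * (\<Sum>x\<in>H. f x)"
    using P by (simp add: sum.subset_diff[of P H f] sum_distrib_left add.commute distrib_left)
  finally have "p * (M * t) + (M - p) * (t * m) \<le> M * (M + (t - 1) * m)"
    by (simp add: total)
  \<comment> \<open>Over the integers the common term \<open>M t m\<close> cancels, leaving
    \<open>p t (M - m) \<le> M (M - m)\<close>; properness of \<open>W\<close> makes
    \<open>M - m\<close> positive.\<close>
  then have "int (p * (M * t) + (M - p) * (t * m)) \<le> int (M * (M + (t - 1) * m))"
    by (simp only: of_nat_le_iff)
  then have "int p * (int M * int t) + (int M - int p) * (int t * int m)
      \<le> int M * (int M + (int t - 1) * int m)"
    using pM t1 by (simp add: of_nat_diff)
  then have "(int p * int t) * (int M - int m) \<le> int M * (int M - int m)"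
    by (simp add: algebra_simps)
  then have "int p * int t \<le> int M" using mM by simp
  then show ?thesis by (simp add: p_def t_def M_def flip: of_nat_mult)
qed

text \<open>Here \<open>small\<close> is \<open>2 d < 3 t\<close> in terms of cardinalities. The
  last conclusion serves to recognise scalars that preserve \<open>V\<close> as elements of
  \<open>H\<close>.\<close>

lemma small_product_imp_subfield:
  fixes U V :: "'a::{field,finite} set"
  assumes U: "diff_closed U" and V: "diff_closed V" "V \<noteq> {0}"
    and prod: "\<And>x y. x \<in> V \<Longrightarrow> y \<in> V \<Longrightarrow> x * y \<in> U"
    and small: "card U ^ 2 < card V ^ 3"
  obtains H v where "is_subfield H" "v \<in> V" "v \<noteq> 0" "V \<subseteq> (*) v ` H" "(*) (v\<^sup>2) ` H \<subseteq> U"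
    "\<And>x. (*) x ` V \<subseteq> V \<Longrightarrow> x \<in> H"
proof -
  define H where "H = {x. \<exists>v\<in>V. v \<noteq> 0 \<and> x * v \<in> V}"
  obtain v where v: "v \<in> V" "v \<noteq> 0" using V diff_closed_zero by blast
  \<comment> \<open>The denominators of \<open>x\<close> in \<open>V\<close>, together with
    0.\<close>
  define R where "R x = {u \<in> V. x * u \<in> V}" for x
  have Rd: "diff_closed (R x)" for x
    using V by (auto simp: R_def diff_closed_def right_diff_distrib)
  have V0: "card V > 0" using v by (simp add: card_gt_0_iff) auto
  have sub: "(*) u ` V \<subseteq> U" if "u \<in> V" for u using prod that by auto
  have R: "card V ^ 2 \<le> card (R x) * card U" if "x \<in> H" for x
  proof (cases "x = 0")
    case True
    then have "R x = V" using V by (auto simp: R_def diff_closed_def)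
    moreover have "card V \<le> card U"
      using card_mono[OF _ sub[OF v(1)]] v by (simp add: card_mult_image)
    ultimately show ?thesis by (simp add: power2_eq_square)
  next
    case False
    from that obtain u where u: "u \<in> V" "u \<noteq> 0" "x * u \<in> V" by (auto simp: H_def)
    define w where "w = x * u"
    have w: "w \<in> V" "w \<noteq> 0" using u False by (auto simp: w_def)
    \<comment> \<open>Since \<open>x = w / u\<close> and both \<open>w V\<close> and
      \<open>u V\<close> lie in \<open>U\<close>, their intersection has at least
      \<open>card V ^ 2 / card U\<close> elements.\<close>
    have "(*) w ` R x = (*) w ` V \<inter> (*) u ` V"
    proof (intro equalityI subsetI)
      fix z assume "z \<in> (*) w ` R x"
      then obtain y where y: "y \<in> V" "x * y \<in> V" "z = w * y" by (auto simp: R_def)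
      then have "z = u * (x * y)" by (simp add: w_def)
      then show "z \<in> (*) w ` V \<inter> (*) u ` V" using y by blast
    next
      fix z assume "z \<in> (*) w ` V \<inter> (*) u ` V"
      then obtain a b where "a \<in> V" "b \<in> V" "z = w * a" "z = u * b" by auto
      then show "z \<in> (*) w ` R x"
        using u by (intro image_eqI[of _ _ a]) (auto simp: R_def w_def)
    qed
    then have "card (R x) = card ((*) w ` V \<inter> (*) u ` V)"
      using card_mult_image[OF w(2)] by metis
    moreover have "card ((*) w ` V) * card ((*) u ` V) \<le> card ((*) w ` V \<inter> (*) u ` V) * card U"
      using U V u w by (intro card_prod_le_card_inter_mult diff_closed_mult_image sub) auto
    ultimately show ?thesis using u w by (simp add: card_mult_image power2_eq_square)
  qed
  have common: "\<exists>u\<in>V. u \<noteq> 0 \<and> x * u \<in> V \<and> y * u \<in> V" if xy: "x \<in> H" "y \<in> H" for x y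
  proof -
    \<comment> \<open>\<open>R x\<close> and \<open>R y\<close> lie in \<open>V\<close>, so the
      intersection bound applies a second time, and \<open>small\<close> then forces a nonzero
      common element.\<close>
    have "card V * (card V ^ 3) = card V ^ 2 * card V ^ 2" by (simp add: power2_eq_square power3_eq_cube)
    also have "\<dots> \<le> (card (R x) * card U) * (card (R y) * card U)"
      using R xy by (intro mult_mono) auto
    also have "\<dots> = (card (R x) * card (R y)) * card U ^ 2" by (simp add: power2_eq_square)
    also have "\<dots> \<le> (card (R x \<inter> R y) * card V) * card U ^ 2"
      using V Rd by (intro mult_mono card_prod_le_card_inter_mult) (auto simp: R_def)
    finally have "card V ^ 3 \<le> card (R x \<inter> R y) * card U ^ 2" using V0 by simp
    with small have "1 * card U ^ 2 < card (R x \<inter> R y) * card U ^ 2" by linarith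
    then have "1 < card (R x \<inter> R y)" by (metis mult_less_cancel2)
    then have "\<not> R x \<inter> R y \<subseteq> {0}" using card_mono[of "{0}" "R x \<inter> R y"] by auto
    then show ?thesis by (auto simp: R_def)
  qed
  have V_H: "w * inverse v \<in> H" if "w \<in> V" for w
    unfolding H_def using v that by (auto intro!: bexI[of _ v] simp: mult.assoc)
  have H0: "0 \<in> H" using v V by (auto simp: H_def diff_closed_zero)
  have H1: "1 \<in> H" using v by (auto simp: H_def)
  have Hdiff: "x - y \<in> H" if xy: "x \<in> H" "y \<in> H" for x y
    using common[OF xy] diff_closed_diff[OF V(1)] by (auto simp: H_def left_diff_distrib)
  have Hinv: "inverse x \<in> H" if x: "x \<in> H" for x
  proof (cases "x = 0")
    case False
    from x obtain u where u: "u \<in> V" "u \<noteq> 0" "x * u \<in> V" by (auto simp: H_def)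
    have "inverse x * (x * u) = u" using False by simp
    with u have "inverse x * (x * u) \<in> V" by (simp only:)
    moreover have "x * u \<noteq> 0" using False u by simp
    ultimately show ?thesis using u(3) unfolding H_def by blast
  qed (simp add: H0)
  have Hmult: "x * y \<in> H" if xy: "x \<in> H" "y \<in> H" for x y
  proof (cases "y = 0")
    case False
    \<comment> \<open>A common denominator of \<open>x\<close> and \<open>inverse y\<close> turns
      \<open>x y\<close> into the quotient of \<open>x u\<close> by
      \<open>inverse y * u\<close>.\<close>
    obtain u where u: "u \<in> V" "u \<noteq> 0" "x * u \<in> V" "inverse y * u \<in> V"
      using common[OF xy(1) Hinv[OF xy(2)]] by auto
    have "x * y * (inverse y * u) = x * u" using False by simp
    with u have "x * y * (inverse y * u) \<in> V" by (simp only:)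
    moreover have "inverse y * u \<noteq> 0" using False u by simp
    ultimately show ?thesis using u(4) unfolding H_def by blast
  qed (simp add: H0)
  have Hd: "diff_closed H" using H0 Hdiff by (auto simp: diff_closed_def)
  have Hsf: "is_subfield H"
    unfolding is_subfield_def using H0 H1 Hmult Hinv diff_closed_add[OF Hd] diff_closed_uminus[OF Hd] by auto
  have VH: "V \<subseteq> (*) v ` H"
  proof
    fix x assume "x \<in> V"
    then show "x \<in> (*) v ` H" using V_H v by (intro image_eqI[of _ _ "x * inverse v"]) auto
  qed
  \<comment> \<open>Division by \<open>v\<close> moves \<open>V\<close> into \<open>H\<close>.
    Products of two elements of \<open>T\<close> lie in \<open>W\<close>, so a proper
    \<open>W\<close> would give \<open>card V ^ 2 \<le> card H\<close> by the annihilator bound with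
    \<open>P = T\<close>.\<close>
  define T where "T = (*) (inverse v) ` V"
  define W where "W = {x \<in> H. v\<^sup>2 * x \<in> U}"
  have "W = H"
  proof (rule ccontr)
    assume "W \<noteq> H"
    then have "W \<subset> H" by (auto simp: W_def)
    moreover have "diff_closed W"
      using U Hd by (auto simp: W_def diff_closed_def right_diff_distrib)
    moreover have TH: "T \<subseteq> H" using V_H by (auto simp: T_def mult.commute)
    moreover have "x * y \<in> W" if "x \<in> T" "y \<in> T" for x y
    proof -
      have "v * x \<in> V" "v * y \<in> V" using that v by (auto simp: T_def mult.assoc[symmetric])
      then have "v\<^sup>2 * (x * y) \<in> U" using prod[of "v * x" "v * y"]
        by (simp add: power2_eq_square mult.assoc mult.left_commute)
      then show ?thesis using that TH Hmult by (auto simp: W_def)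
    qed
    ultimately have "card T * card T \<le> card H"
      using Hsf V by (intro card_annihilator_le[of H W]) (auto simp: T_def intro: diff_closed_mult_image)
    then have 1: "card V * card V \<le> card H" using v by (simp add: T_def card_mult_image)
    \<comment> \<open>Excluding the denominator 0 makes the number of quotients strictly smaller
      than \<open>card V ^ 2\<close>.\<close>
    have "H \<subseteq> (\<lambda>(w, u). w * inverse u) ` (V \<times> (V - {0}))"
    proof
      fix x assume "x \<in> H"
      then obtain u where "u \<in> V" "u \<noteq> 0" "x * u \<in> V" by (auto simp: H_def)
      then show "x \<in> (\<lambda>(w, u). w * inverse u) ` (V \<times> (V - {0}))"
        by (intro image_eqI[of _ _ "(x * u, u)"]) auto
    qed
    then have "card H \<le> card (V \<times> (V - {0}))"
      by (meson card_image_le card_mono finite le_trans)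
    also have "\<dots> = card V * (card V - 1)"
      using diff_closed_zero[OF V(1)] by (simp add: card_cartesian_product)
    also have "\<dots> < card V * card V" using V0 by simp
    finally show False using 1 by simp
  qed
  then have "(*) (v\<^sup>2) ` H \<subseteq> U" by (auto simp: W_def)
  moreover have "x \<in> H" if "(*) x ` V \<subseteq> V" for x
    using that v by (auto simp: H_def)
  ultimately show ?thesis using that Hsf v VH by blast
qed

section \<open>Subfields of finite fields\<close>

text \<open>Translation by 1 permutes the ring, so adding 1 to every element leaves the sum of all
  elements unchanged.\<close>

lemma of_nat_CARD_eq_0: "of_nat CARD('a) = (0 :: 'a::{comm_ring_1,finite})"
proof -
  have "(\<Sum>x\<in>UNIV. x + 1 :: 'a) = (\<Sum>x\<in>UNIV. x)"
    by (rule sum.reindex_bij_witness[of _ "\<lambda>x. x - 1" "\<lambda>x. x + 1"]) auto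
  then show ?thesis by (simp add: sum.distrib)
qed

text \<open>Makes raising to a power of \<open>q\<close> an iterate of Frobenius, hence
  additive.\<close>

lemma primepow_CARD_imp_CHAR_power:
  assumes "primepow q" "CARD('a::{field,finite}) = q ^ n"
  obtains j where "q = CHAR('a) ^ j" "prime CHAR('a)"
proof -
  from assms obtain p j where p: "prime p" "q = p ^ j" by (auto simp: primepow_def)
  have "prime CHAR('a)"
    by (intro prime_CHAR_semidom finite_imp_CHAR_pos) simp
  moreover have "CHAR('a) dvd p ^ (j * n)"
    using of_nat_CARD_eq_0[where 'a='a] unfolding of_nat_eq_0_iff_char_dvd assms p power_mult .
  ultimately have "CHAR('a) = p"
    using p by (meson prime_dvd_power primes_dvd_imp_eq)
  then show ?thesis using that p \<open>prime CHAR('a)\<close> by auto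
qed

text \<open>Fermat's argument: multiplication by a nonzero \<open>x\<close> permutes the nonzero
  elements of \<open>S\<close>, whose product can be cancelled.\<close>

lemma subfield_power_card:
  fixes S :: "'a::field set"
  assumes S: "is_subfield S" "finite S" and x: "x \<in> S"
  shows "x ^ card S = x"
proof -
  have "0 \<in> S" using S by (simp add: is_subfield_def)
  then have card: "card S = Suc (card (S - {0}))" by (rule card.remove[OF S(2)])
  show ?thesis
  proof (cases "x = 0")
    case False
    have "(\<Prod>y\<in>S - {0}. x * y) = (\<Prod>y\<in>S - {0}. y)"
      using S x False unfolding is_subfield_def
      by (intro prod.reindex_bij_witness[of _ "\<lambda>y. inverse x * y" "\<lambda>y. x * y"]) auto
    then have "x ^ card (S - {0}) * (\<Prod>y\<in>S - {0}. y) = 1 * (\<Prod>y\<in>S - {0}. y)"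
      by (simp add: prod.distrib)
    moreover have "(\<Prod>y\<in>S - {0}. y) \<noteq> 0" using S by simp
    ultimately have "x ^ card (S - {0}) = 1" by (metis mult_right_cancel)
    then show ?thesis by (simp add: card)
  qed (simp add: card)
qed

text \<open>Counts roots of \<open>X ^ m - X\<close>, a polynomial that would vanish for
  \<open>m = 1\<close>.\<close>

lemma card_power_fixed_points_le:
  assumes "m \<ge> 2"
  shows "card {x::'a::idom. x ^ m = x} \<le> m"
proof -
  define f :: "'a poly" where "f = monom 1 m - monom 1 1"
  have "coeff f m = 1" using assms by (simp add: f_def)
  then have "f \<noteq> 0" by auto
  moreover have "degree f \<le> m"
    using assms unfolding f_def by (intro degree_diff_le) (auto simp: degree_monom_eq)
  moreover have "{x. poly f x = 0} = {x. x ^ m = x}" by (auto simp: f_def poly_monom)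
  ultimately show ?thesis using card_poly_roots_bound[of f] by simp
qed

lemma card_subfield_ge_2:
  fixes S :: "'a::field set"
  assumes "is_subfield S" "finite S"
  shows "card S \<ge> 2"
proof -
  have "card {0, 1::'a} \<le> card S"
    using assms by (intro card_mono) (auto simp: is_subfield_def)
  then show ?thesis by simp
qed

text \<open>All of \<open>S\<close> consists of roots of \<open>X ^ card S - X\<close>, and there
  are no further roots. So a subfield is determined by its cardinality, which justifies the definite
  description in \<open>subfield_of_card\<close>.\<close>

lemma subfield_eq_power_fixed_points:
  fixes S :: "'a::{field,finite} set"
  assumes "is_subfield S"
  shows "S = {x. x ^ card S = x}"
proof (rule card_seteq)
  show "S \<subseteq> {x. x ^ card S = x}" using subfield_power_card[OF assms finite] by blast
  show "card {x::'a. x ^ card S = x} \<le> card S"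
    by (rule card_power_fixed_points_le[OF card_subfield_ge_2[OF assms finite]])
qed simp

lemma subfield_of_card_eq:
  fixes S :: "'a::{field,finite} set"
  assumes "is_subfield S" "card S = m"
  shows "subfield_of_card m = S"
  unfolding subfield_of_card_def
proof (rule the_equality)
  fix S' :: "'a set" assume "is_subfield S' \<and> card S' = m"
  then show "S' = S"
    using subfield_eq_power_fixed_points[of S'] subfield_eq_power_fixed_points[OF assms(1)] assms(2)
    by simp
qed (simp add: assms)

lemma power_CARD_eq_self: "x ^ CARD('a) = (x :: 'a::{field,finite})"
  by (rule subfield_power_card) (auto simp: is_subfield_def)

lemma power_power_iterate_fixed:
  fixes x :: "'a::monoid_mult"
  assumes "x ^ m = x"
  shows "x ^ (m ^ k) = x"
  by (induction k) (simp_all add: power_mult assms)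

text \<open>Elements of \<open>H\<close> are fixed by the powers \<open>q ^ h\<close> and
  \<open>q ^ n\<close>, hence by \<open>q ^ (n mod h)\<close>. A positive remainder would allow
  fewer than \<open>q ^ h\<close> fixed points.\<close>

lemma subfield_degree_dvd:
  fixes H :: "'a::{field,finite} set"
  assumes H: "is_subfield H" "card H = q ^ h" and q: "q \<ge> 2" and h: "h > 0" and n: "CARD('a) = q ^ n"
  shows "h dvd n"
proof (rule ccontr)
  assume "\<not> h dvd n"
  then have r: "n mod h > 0" by (simp add: mod_greater_zero_iff_not_dvd)
  have "x ^ (q ^ (n mod h)) = x" if "x \<in> H" for x
  proof -
    have "x ^ (q ^ h) = x" using subfield_power_card[OF H(1) _ that] H(2) by simp
    then have fixed: "x ^ ((q ^ h) ^ (n div h)) = x" by (rule power_power_iterate_fixed)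
    have "x = x ^ (q ^ n)" using power_CARD_eq_self[of x] n by simp
    also have "q ^ n = (q ^ h) ^ (n div h) * q ^ (n mod h)"
      by (metis mult_div_mod_eq power_add power_mult)
    also have "x ^ \<dots> = x ^ (q ^ (n mod h))" by (simp add: power_mult fixed)
    finally show ?thesis by simp
  qed
  then have "card H \<le> card {x::'a. x ^ (q ^ (n mod h)) = x}" by (intro card_mono) auto
  also have "\<dots> \<le> q ^ (n mod h)"
    using q r self_le_power[of q "n mod h"] by (intro card_power_fixed_points_le) linarith
  also have "\<dots> < q ^ h" using q h by (intro power_strict_increasing) auto
  finally show False using H by simp
qed

text \<open>
  The subfield is the kernel of the additive map \<open>x \<mapsto> x ^ m - x\<close> with \<open>m = q ^ D\<close>. Its image
  consists of roots of \<open>y + y ^ m + \<dots> + y ^ m ^ (n / D - 1)\<close>, which bounds the kernel from below.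
\<close>

lemma ex_subfield_of_card:
  assumes q: "primepow q" and n: "CARD('a::{field,finite}) = q ^ n" "n > 0" and D: "D dvd n"
  shows "\<exists>S :: 'a set. is_subfield S \<and> card S = q ^ D"
proof -
  obtain j where j: "q = CHAR('a) ^ j" and p: "prime CHAR('a)"
    using primepow_CARD_imp_CHAR_power[OF q n(1)] by blast
  have q2: "q \<ge> 2" using primepow_gt_Suc_0[OF q] by simp
  obtain e where e: "n = D * e" using D by (elim dvdE)
  have De: "D > 0" "e > 0" using n e by auto
  define m where "m = q ^ D"
  have m2: "m \<ge> 2" unfolding m_def using q2 De self_le_power[of q D] by linarith
  \<comment> \<open>\<open>m ^ i\<close> is a power of the characteristic.\<close>
  have add: "(x + y) ^ (m ^ i) = x ^ (m ^ i) + y ^ (m ^ i)" for x y :: 'a and i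
    by (rule freshmans_dream'[OF p, of _ "j * D * i"]) (simp add: m_def j power_mult)
  have diff: "(x - y) ^ (m ^ i) = x ^ (m ^ i) - y ^ (m ^ i)" for x y :: 'a and i
    using add[of "x - y" y i] by (simp add: algebra_simps)
  define S where "S = {x::'a. x ^ m = x}"
  define T where "T x = x ^ m - x" for x :: 'a
  have S0: "0 \<in> S" using m2 by (simp add: S_def)
  have Sdiff: "x - y \<in> S" if "x \<in> S" "y \<in> S" for x y
    using diff[of x y 1] that by (simp add: S_def)
  have Sminus: "- x \<in> S" if "x \<in> S" for x
    using Sdiff[OF S0 that] by simp
  have "is_subfield S"
    unfolding is_subfield_def
  proof (intro conjI ballI)
    fix x y assume "x \<in> S" "y \<in> S"
    then show "x + y \<in> S" "x * y \<in> S"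
      using add[of x y 1] by (auto simp: S_def power_mult_distrib)
  qed (use S0 Sminus in \<open>auto simp: S_def power_inverse\<close>)
  moreover have "card S = m"
  proof (rule antisym)
    show "card S \<le> m" unfolding S_def using m2 by (rule card_power_fixed_points_le)
    define f :: "'a poly" where "f = (\<Sum>i<e. monom 1 (m ^ i))"
    have inj: "m ^ i = m ^ k \<longleftrightarrow> i = k" for i k using m2 by (intro power_inject_exp) auto
    have "coeff f (m ^ (e - 1)) = 1"
      using De by (simp add: f_def coeff_sum inj)
    then have "f \<noteq> 0" by auto
    moreover have "degree f \<le> m ^ (e - 1)"
      unfolding f_def using m2 by (intro degree_sum_le) (auto simp: degree_monom_eq intro!: power_increasing)
    moreover have "T x \<in> {y. poly f y = 0}" for x
    proof -
      \<comment> \<open>Additivity makes the sum telescope, and its two ends agree because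
        \<open>m ^ e\<close> is the size of the field.\<close>
      have "poly f (T x) = (\<Sum>i<e. x ^ (m ^ Suc i) - x ^ (m ^ i))"
        by (simp add: f_def poly_sum poly_monom T_def diff power_mult)
      also have "\<dots> = x ^ (m ^ e) - x"
        using sum_lessThan_telescope[of "\<lambda>i. x ^ (m ^ i)" e] by simp
      also have "m ^ e = CARD('a)" by (simp add: n e m_def power_mult)
      finally show ?thesis by (simp add: power_CARD_eq_self)
    qed
    ultimately have "card (range T) \<le> m ^ (e - 1)"
      using card_poly_roots_bound[of f] card_mono[of "{y. poly f y = 0}" "range T"] by fastforce
    \<comment> \<open>The field is split into the fibres of \<open>T\<close>; subtracting a point of
      a fibre maps it injectively into the kernel \<open>S\<close>.\<close>
    have "m * m ^ (e - 1) = CARD('a)"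
      using De by (simp add: n e m_def power_mult flip: power_Suc)
    also have "\<dots> \<le> card (\<Union>y\<in>range T. T -` {y})" by (intro card_mono) auto
    also have "\<dots> \<le> (\<Sum>y\<in>range T. card (T -` {y}))" by (intro card_UN_le) simp
    also have "\<dots> \<le> (\<Sum>y\<in>range T. card S)"
    proof (rule sum_mono)
      fix y assume "y \<in> range T"
      then obtain x0 where x0: "y = T x0" by auto
      have "(\<lambda>x. x - x0) ` (T -` {y}) \<subseteq> S"
      proof (rule image_subsetI)
        fix x assume "x \<in> T -` {y}"
        then have "x ^ m - x = x0 ^ m - x0" by (simp add: T_def x0)
        then have "x ^ m - x0 ^ m = x - x0" by (simp add: algebra_simps)
        then show "x - x0 \<in> S" using diff[of x x0 1] by (simp add: S_def)
      qed
      moreover have "inj_on (\<lambda>x. x - x0) (T -` {y})" by (simp add: inj_on_def)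
      ultimately show "card (T -` {y}) \<le> card S" by (intro card_inj_on_le) auto
    qed
    also have "\<dots> = card S * card (range T)" by simp
    also have "\<dots> \<le> card S * m ^ (e - 1)"
      using \<open>card (range T) \<le> m ^ (e - 1)\<close> by simp
    finally show "m \<le> card S" using m2 by simp
  qed
  ultimately show ?thesis by (auto simp: m_def)
qed

section \<open>Cliques of the product graph\<close>

lemma (in vector_space) card_span_independent:
  assumes "finite B" "independent B"
  shows "card (span B) = card (UNIV :: 'a set) ^ card B"
  using assms
proof (induction B rule: finite_induct)
  case (insert b B)
  then have b: "b \<notin> span B" and B: "independent B" by (auto simp: independent_insert)
  \<comment> \<open>An element of the larger span has a unique coordinate at
    \<open>b\<close>.\<close>
  have "bij_betw (\<lambda>(c, x). c *s b + x) (UNIV \<times> span B) (span (insert b B))"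
    unfolding bij_betw_def
  proof
    show "inj_on (\<lambda>(c, x). c *s b + x) (UNIV \<times> span B)"
    proof (intro inj_onI, clarify)
      fix c x c' x' assume x: "x \<in> span B" "x' \<in> span B" and eq: "c *s b + x = c' *s b + x'"
      then have 1: "(c - c') *s b = x' - x" by (simp add: scale_left_diff_distrib algebra_simps)
      have "c = c'"
      proof (rule ccontr)
        assume "c \<noteq> c'"
        then have "b = inverse (c - c') *s (x' - x)" by (simp flip: 1)
        then show False using b x by (metis span_scale span_diff)
      qed
      then show "c = c' \<and> x = x'" using eq by simp
    qed
    show "(\<lambda>(c, x). c *s b + x) ` (UNIV \<times> span B) = span (insert b B)"
    proof (intro equalityI subsetI)
      fix y assume "y \<in> span (insert b B)"
      then obtain k where "y - k *s b \<in> span B" by (auto simp: span_insert)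
      then show "y \<in> (\<lambda>(c, x). c *s b + x) ` (UNIV \<times> span B)"
        by (intro image_eqI[of _ _ "(k, y - k *s b)"]) auto
    next
      fix y assume "y \<in> (\<lambda>(c, x). c *s b + x) ` (UNIV \<times> span B)"
      then obtain c x where "x \<in> span B" "y = c *s b + x" by auto
      then have "y - c *s b \<in> span B" by simp
      then show "y \<in> span (insert b B)" by (auto simp: span_insert)
    qed
  qed
  then have "card (span (insert b B)) = card (UNIV :: 'a set) * card (span B)"
    by (simp add: card_cartesian_product flip: bij_betw_same_card)
  then show ?case using insert B by simp
qed simp

lemma (in vector_space) card_subspace:
  assumes "subspace V" "finite V"
  shows "card V = card (UNIV :: 'a set) ^ dim V"
proof -
  obtain B where B: "B \<subseteq> V" "independent B" "V \<subseteq> span B" "card B = dim V"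
    by (rule basis_exists)
  then have "span B = V" using assms by (simp add: span_minimal subset_antisym)
  then show ?thesis using card_span_independent[OF finite_subset[OF B(1) assms(2)] B(2)] B by simp
qed

section \<open>Cliques in terms of products\<close>

lemma is_clique_product_graph_iff:
  "is_clique (product_graph U) C \<longleftrightarrow> (\<forall>a\<in>C. \<forall>b\<in>C. a \<noteq> b \<longrightarrow> a * b \<in> U)"
proof -
  have "{a, b} \<in> snd (product_graph U) \<longleftrightarrow> a * b \<in> U" if "a \<noteq> b" for a b
    using that unfolding product_graph_def by (auto simp: doubleton_eq_iff mult.commute)
  then show ?thesis unfolding is_clique_def by (auto simp: product_graph_def)
qed

lemma clique_card_le_clique_number:
  fixes G :: "'v::finite graph"
  shows "is_clique G C \<Longrightarrow> card C \<le> clique_number G"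
  unfolding clique_number_def by (intro Max_ge) auto

lemma obtain_maximum_clique:
  fixes G :: "'v::finite graph"
  obtains C where "is_clique G C" "card C = clique_number G"
proof -
  have "is_clique G {}" by (simp add: is_clique_def)
  then have "clique_number G \<in> card ` {C. is_clique G C}"
    unfolding clique_number_def by (intro Max_in) auto
  then show ?thesis using that by auto
qed

section \<open>Subspaces of the extension field under multiplication\<close>

locale finite_field_extension = field_extension emb
  for emb :: "'k::{field,finite} \<Rightarrow> 'a::{field,finite}"
begin

sublocale vector_space "ext_scale emb" by (rule vector_space_ext_scale)

lemma subspace_diff_closed: "subspace U \<Longrightarrow> diff_closed U"
  by (simp add: diff_closed_def subspace_0 subspace_diff)

lemma card_subspace_ext: "subspace U \<Longrightarrow> card U = CARD('k) ^ dim U"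
  by (simp add: card_subspace)

lemma CARD_ge_2: "CARD('k) \<ge> 2"
  using card_mono[of UNIV "{0, 1::'k}"] by simp

lemma emb_eq_0_iff: "emb c = 0 \<longleftrightarrow> c = 0"
proof -
  have "emb 0 = 0" using emb_add[of 0 0] by (metis add_0 add_cancel_left_left)
  moreover have "emb c \<noteq> 0" if "c \<noteq> 0"
    using emb_mult[of c "inverse c"] that emb_one by auto
  ultimately show ?thesis by auto
qed

text \<open>Carries a product condition from a generating set to its span.\<close>

lemma subspace_mult_preimage:
  assumes "subspace U"
  shows "subspace {x. y * x \<in> U}"
  using assms by (auto simp: subspace_def ext_scale_def distrib_left mult.left_commute[of y])

text \<open>Multiplication by \<open>x\<close> embeds \<open>span A\<close> into \<open>U\<close>,
  and cardinalities are compared.\<close>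

lemma card_independent_le_dim:
  assumes U: "subspace U" and x: "x \<noteq> 0" and A: "independent A" "\<And>a. a \<in> A \<Longrightarrow> x * a \<in> U"
  shows "card A \<le> dim U"
proof -
  have "span A \<subseteq> {a. x * a \<in> U}"
    using A by (intro span_minimal subspace_mult_preimage[OF U]) auto
  then have "(*) x ` span A \<subseteq> U" by auto
  then have "card ((*) x ` span A) \<le> card U" by (intro card_mono) auto
  then have "CARD('k) ^ card A \<le> CARD('k) ^ dim U"
    using A x by (simp add: card_mult_image card_span_independent card_subspace_ext[OF U])
  then show ?thesis using CARD_ge_2 by (simp add: power_le_imp_le_exp)
qed

text \<open>Elements of \<open>B\<close> are adjoined one at a time: \<open>b\<close> times the span
  of the earlier ones lies in \<open>U\<close>, whereas \<open>b * b\<close> does not.\<close>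

lemma independent_Un_nonsquares:
  assumes U: "subspace U" and A: "independent A" and "finite B"
    and AB: "\<And>a b. a \<in> A \<Longrightarrow> b \<in> B \<Longrightarrow> b * a \<in> U"
    and BB: "\<And>b c. b \<in> B \<Longrightarrow> c \<in> B \<Longrightarrow> b \<noteq> c \<Longrightarrow> b * c \<in> U"
    and sq: "\<And>b. b \<in> B \<Longrightarrow> b * b \<notin> U"
  shows "independent (A \<union> B)"
  using \<open>finite B\<close> AB BB sq
proof (induction B rule: finite_induct)
  case (insert b B)
  have "span (A \<union> B) \<subseteq> {x. b * x \<in> U}"
    using insert.prems(1,2)[of _ b] insert.prems(2)[of b] insert.hyps
    by (intro span_minimal subspace_mult_preimage[OF U]) auto
  then have "b \<notin> span (A \<union> B)" using insert.prems(3)[of b] by auto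
  then show ?case using insert by (simp add: independent_insertI)
qed (simp add: A)

lemma maximum_clique_decomposition:
  assumes U: "subspace U"
  obtains V B where "subspace V" "\<And>x y. x \<in> V \<Longrightarrow> y \<in> V \<Longrightarrow> x * y \<in> U"
    "\<And>x b. x \<in> V \<Longrightarrow> b \<in> B \<Longrightarrow> b * x \<in> U"
    "\<And>b c. b \<in> B \<Longrightarrow> c \<in> B \<Longrightarrow> b \<noteq> c \<Longrightarrow> b * c \<in> U"
    "\<And>b. b \<in> B \<Longrightarrow> b * b \<notin> U"
    "clique_number (product_graph U) = card V + card B"
proof -
  obtain C where C: "is_clique (product_graph U) C" "card C = clique_number (product_graph U)"
    by (rule obtain_maximum_clique)
  have clique: "a * b \<in> U" if "a \<in> C" "b \<in> C" "a \<noteq> b" for a b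
    using C(1) that by (auto simp: is_clique_product_graph_iff)
  define A where "A = {a \<in> C. a * a \<in> U}"
  define B where "B = C - A"
  define V where "V = span A"
  \<comment> \<open>An element of \<open>A\<close> can meet itself, where its square lies in
    \<open>U\<close>; an element of \<open>B\<close> is never in \<open>A\<close>, so the clique
    condition suffices.\<close>
  have CV: "c * v \<in> U" if "c \<in> C" "c \<in> A \<or> c \<in> B" "v \<in> V" for c v
  proof -
    have "A \<subseteq> {x. c * x \<in> U}" using that clique by (auto simp: A_def B_def)
    then have "V \<subseteq> {x. c * x \<in> U}"
      unfolding V_def by (intro span_minimal subspace_mult_preimage[OF U])
    then show ?thesis using that by auto
  qed
  have VV: "x * y \<in> U" if "x \<in> V" "y \<in> V" for x y
  proof -
    have "A \<subseteq> {z. x * z \<in> U}" using CV[of _ x] that by (auto simp: A_def mult.commute)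
    then have "V \<subseteq> {z. x * z \<in> U}"
      unfolding V_def by (intro span_minimal subspace_mult_preimage[OF U])
    then show ?thesis using that by auto
  qed
  have VB: "b * x \<in> U" if "x \<in> V" "b \<in> B" for x b
    using CV[of b x] that by (auto simp: B_def)
  have BB: "b * c \<in> U" if "b \<in> B" "c \<in> B" "b \<noteq> c" for b c
    using clique that by (auto simp: B_def)
  have sq: "b * b \<notin> U" if "b \<in> B" for b
    using that by (auto simp: B_def A_def)
  have disj: "V \<inter> B = {}" using VV sq by auto
  have "is_clique (product_graph U) (V \<union> B)"
    unfolding is_clique_product_graph_iff
  proof (intro ballI impI)
    fix a b assume "a \<in> V \<union> B" "b \<in> V \<union> B" "a \<noteq> b"
    then show "a * b \<in> U" using VV VB[of a b] VB[of b a] BB by (auto simp: mult.commute[of a])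
  qed
  \<comment> \<open>Maximality of \<open>C\<close> gives one inequality, and
    \<open>C \<subseteq> V \<union> B\<close> the other.\<close>
  then have "card (V \<union> B) \<le> card C"
    using C(2) clique_card_le_clique_number by metis
  moreover have "C \<subseteq> V \<union> B" unfolding V_def B_def using span_superset[of A] by auto
  then have "card C \<le> card (V \<union> B)" by (intro card_mono) auto
  ultimately have "clique_number (product_graph U) = card V + card B"
    using disj C(2) by (simp add: card_Un_disjoint)
  then show ?thesis using that[of V B] VV VB BB sq by (auto simp: V_def)
qed

section \<open>The base field and larger subfields\<close>

lemma is_subfield_range_emb: "is_subfield (range emb)"
proof -
  have e0: "emb 0 = 0" by (simp add: emb_eq_0_iff)
  have m: "emb (- x) = - emb x" for x
    using emb_add[of x "- x"] e0 by (simp add: eq_neg_iff_add_eq_0 add.commute)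
  have i: "emb (inverse x) = inverse (emb x)" for x
    using emb_mult[of x "inverse x"] e0 emb_one
    by (cases "x = 0") (auto intro!: inverse_unique[symmetric])
  show ?thesis
    unfolding is_subfield_def
    using e0 emb_one by (auto simp flip: emb_add emb_mult m i)
qed

lemma card_range_emb: "card (range emb) = CARD('k)"
proof -
  have "emb (x - y) = emb x - emb y" for x y
    using emb_add[of "x - y" y] by (simp add: algebra_simps)
  then have "inj emb" by (intro injI) (metis emb_eq_0_iff eq_iff_diff_eq_0)
  then show ?thesis by (simp add: card_image)
qed

text \<open>The witness \<open>h\<close> is the degree over the base field of the subfield
  \<open>H\<close> of quotients; \<open>V \<subseteq> v H\<close> gives
  \<open>dim V \<le> h\<close>.\<close>

lemma dim_le_or_subfield_multiple:
  assumes U: "subspace U" and V: "subspace V" "V \<noteq> {0}"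
    and prod: "\<And>x y. x \<in> V \<Longrightarrow> y \<in> V \<Longrightarrow> x * y \<in> U"
    and n: "CARD('a) = CARD('k) ^ n"
  shows "3 * dim V \<le> 2 * dim U \<or> (\<exists>h \<ge> dim V. square_subfield_divisor CARD('k) n U h)"
proof (cases "3 * dim V \<le> 2 * dim U")
  case False
  then have "CARD('k) ^ (dim U * 2) < CARD('k) ^ (dim V * 3)"
    using CARD_ge_2 by (intro power_strict_increasing) auto
  then have "card U ^ 2 < card V ^ 3"
    using U V by (simp add: card_subspace_ext power_mult)
  then obtain H v where H: "is_subfield H" "v \<in> V" "v \<noteq> 0" "V \<subseteq> (*) v ` H" "(*) (v\<^sup>2) ` H \<subseteq> U"
    "\<And>x. (*) x ` V \<subseteq> V \<Longrightarrow> x \<in> H"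
    using small_product_imp_subfield[OF subspace_diff_closed[OF U] subspace_diff_closed[OF V(1)] V(2) prod]
    by blast
  \<comment> \<open>Scalars preserve \<open>V\<close>, so \<open>H\<close> contains the base field
    and its cardinality is a power of \<open>CARD('k)\<close>.\<close>
  have "emb c \<in> H" for c
    using H(6)[of "emb c"] V(1) by (auto simp: subspace_def ext_scale_def)
  then have "subspace H" using H(1) by (auto simp: subspace_def is_subfield_def ext_scale_def)
  then have cardH: "card H = CARD('k) ^ dim H" by (rule card_subspace_ext)
  have "dim H > 0"
    using card_subfield_ge_2[OF H(1) finite] cardH by (cases "dim H") auto
  then have "dim H dvd n"
    using subfield_degree_dvd[OF H(1) cardH CARD_ge_2 _ n] by simp
  moreover have "subfield_of_card (CARD('k) ^ dim H) = H"
    using H(1) cardH by (rule subfield_of_card_eq)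
  ultimately have "square_subfield_divisor CARD('k) n U (dim H)"
    unfolding square_subfield_divisor_def using H by auto
  moreover have "card V \<le> card ((*) v ` H)" using H(4) by (intro card_mono) auto
  then have "CARD('k) ^ dim V \<le> CARD('k) ^ dim H"
    using H(3) V(1) by (simp add: card_mult_image cardH card_subspace_ext)
  then have "dim V \<le> dim H" using CARD_ge_2 by (simp add: power_le_imp_le_exp)
  ultimately show ?thesis by blast
qed simp

end

section \<open>Assembling the bounds on the clique number\<close>

theorem theorem2p4:
  fixes emb :: "'k::{field,finite} \<Rightarrow> 'a::{field,finite}"
    and U :: "'a set"
    and q n d D \<omega> :: nat
    and \<kappa> :: real
  assumes "primepow q" and "CARD('k) = q"
    and "n \<ge> 2" and "CARD('a) = q ^ n"
    and "field_extension emb"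
    and "module.subspace (ext_scale emb) U"
    and "U \<noteq> UNIV"
    and "d = vector_space.dim (ext_scale emb) U"
    and "d \<ge> 1"
    and "\<omega> = clique_number (product_graph U)"
    and "D = greatest_divisor q n U"
    and "\<kappa> = kappa q d D"
  shows "((\<nexists>b. b \<noteq> 0 \<and> b\<^sup>2 \<in> U) \<longrightarrow> \<omega> \<le> d + 2) \<and>
    (\<omega> > d + 2 \<longrightarrow>
      square_subfield_divisor q n U D \<and> 1 \<le> D \<and> D \<le> d \<and>
      (\<exists>t r :: nat. \<omega> = q ^ t + r \<and> r + t \<le> d \<and> 1 \<le> t \<and> real t \<le> \<kappa>) \<and>
      q ^ D \<le> \<omega> \<and> real \<omega> \<le> real q powr \<kappa> + real d)"
proof -
  interpret field_extension emb by fact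
  interpret finite_field_extension emb ..
  note q = \<open>CARD('k) = q\<close>
  have q2: "q \<ge> 2" using CARD_ge_2 q by simp
  have U: "subspace U" by fact
  have d: "d = dim U" by fact
  have cardU: "card U = q ^ d" using card_subspace_ext[OF U] q d by simp
  obtain V B where V: "subspace V" and VV: "\<And>x y. x \<in> V \<Longrightarrow> y \<in> V \<Longrightarrow> x * y \<in> U"
    and VB: "\<And>x b. x \<in> V \<Longrightarrow> b \<in> B \<Longrightarrow> b * x \<in> U"
    and BB: "\<And>b c. b \<in> B \<Longrightarrow> c \<in> B \<Longrightarrow> b \<noteq> c \<Longrightarrow> b * c \<in> U"
    and sq: "\<And>b. b \<in> B \<Longrightarrow> b * b \<notin> U"
    and \<omega>: "clique_number (product_graph U) = card V + card B"
    using maximum_clique_decomposition[OF U] by blast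
  have cardV: "card V = q ^ dim V" using card_subspace_ext[OF V] q by simp
  \<comment> \<open>One \<open>b\<close> is set aside as multiplier, because
    \<open>b * b \<notin> U\<close>; the others number at most \<open>d\<close>. Together with
    \<open>b\<close> and the zero vector this makes \<open>d + 2\<close>.\<close>
  have trivial: "\<omega> \<le> d + 2" if "V = {0}"
  proof (cases "B = {}")
    case False
    then obtain b where b: "b \<in> B" by auto
    have "independent ({} \<union> B)"
      using BB sq by (intro independent_Un_nonsquares[OF U independent_empty]) auto
    then have "independent (B - {b})" by (rule independent_mono) auto
    moreover have "b \<noteq> 0" using sq[OF b] subspace_0[OF U] by auto
    ultimately have "card (B - {b}) \<le> d"
      unfolding d using BB[OF b] by (intro card_independent_le_dim[OF U, of b]) auto
    then show ?thesis using that \<omega> assms(10) b by (simp add: card_Diff_singleton)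
  qed (use that \<omega> assms(10) in simp)
  show ?thesis
  proof (intro conjI impI)
    assume no: "\<nexists>b. b \<noteq> 0 \<and> b\<^sup>2 \<in> U"
    \<comment> \<open>Every element of \<open>V\<close> has its square in \<open>U\<close>.\<close>
    have "V = {0}"
      using no VV subspace_0[OF V] by (force simp: power2_eq_square)
    then show "\<omega> \<le> d + 2" by (rule trivial)
  next
    assume "\<omega> > d + 2"
    then have V0: "V \<noteq> {0}" using trivial by auto
    then obtain v where v: "v \<in> V" "v \<noteq> 0" using subspace_0[OF V] by blast
    obtain A where A: "A \<subseteq> V" "independent A" "V \<subseteq> span A" "card A = dim V"
      by (rule basis_exists)
    \<comment> \<open>Multiplication by \<open>v\<close> sends this independent set of size
      \<open>t + r\<close> into \<open>U\<close>.\<close>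
    have "independent (A \<union> B)"
      using A VB BB sq by (intro independent_Un_nonsquares[OF U]) auto
    moreover have "v * a \<in> U" if "a \<in> A \<union> B" for a
      using that A v VV VB[of v a] by (auto simp: mult.commute)
    ultimately have "card (A \<union> B) \<le> d"
      unfolding d using v by (intro card_independent_le_dim[OF U])
    moreover have "A \<inter> B = {}" using A(1) VV sq by blast
    ultimately have rt: "card B + dim V \<le> d" using A by (simp add: card_Un_disjoint)
    have t1: "dim V \<ge> 1"
    proof (rule ccontr)
      assume "\<not> 1 \<le> dim V"
      then have "card V = 1" using cardV by simp
      then show False using V0 subspace_0[OF V] by (auto simp: card_1_singleton_iff)
    qed
    have \<omega>': "\<omega> = q ^ dim V + card B" using \<omega> assms(10) cardV by simp
    \<comment> \<open>Degree 1 is admissible through \<open>v\<^sup>2\<close> times the base field,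
      so the greatest divisor is taken over a nonempty set, bounded by \<open>n\<close>.\<close>
    have "subfield_of_card (q ^ 1) = range emb"
      using is_subfield_range_emb card_range_emb q by (intro subfield_of_card_eq) auto
    moreover have "v\<^sup>2 * emb c \<in> U" for c
      using subspace_scale[OF U VV[OF v(1) v(1)], of c]
      by (simp add: ext_scale_def power2_eq_square mult.commute)
    ultimately have one: "square_subfield_divisor q n U 1"
      unfolding square_subfield_divisor_def using v by auto
    have bound: "h \<le> n" if "square_subfield_divisor q n U h" for h
      using that assms(3) by (auto simp: square_subfield_divisor_def dvd_imp_le)
    have D: "square_subfield_divisor q n U D"
      unfolding assms(11) greatest_divisor_def by (rule GreatestI_nat[where P = "square_subfield_divisor q n U", OF one bound])
    have le_D: "h \<le> D" if "square_subfield_divisor q n U h" for h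
      unfolding assms(11) greatest_divisor_def by (rule Greatest_le_nat[where P = "square_subfield_divisor q n U", OF that bound])
    have "D dvd n" using D by (simp add: square_subfield_divisor_def)
    \<comment> \<open>Existence ensures that \<open>subfield_of_card (q ^ D)\<close> denotes an
      actual subfield.\<close>
    then obtain S :: "'a set" where S: "is_subfield S" "card S = q ^ D"
      using ex_subfield_of_card[OF assms(1,4), of D] assms(3) by auto
    obtain a where a: "a \<noteq> 0" "(*) (a\<^sup>2) ` S \<subseteq> U"
      using D subfield_of_card_eq[OF S] by (auto simp: square_subfield_divisor_def)
    have "card ((*) (a\<^sup>2) ` S) \<le> card U" using a by (intro card_mono) auto
    then have "q ^ D \<le> q ^ d" using a S cardU by (simp add: card_mult_image)
    then have "D \<le> d" using q2 by (simp add: power_le_imp_le_exp)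
    \<comment> \<open>Products of elements of \<open>a S\<close> lie in \<open>a\<^sup>2 S\<close>;
      this clique gives the lower bound.\<close>
    have "is_clique (product_graph U) ((*) a ` S)"
      unfolding is_clique_product_graph_iff
    proof clarify
      fix x y assume "x \<in> S" "y \<in> S"
      then have "x * y \<in> S" using S by (simp add: is_subfield_def)
      then have "a\<^sup>2 * (x * y) \<in> U" using a by auto
      then show "a * x * (a * y) \<in> U" by (simp add: power2_eq_square mult_ac)
    qed
    then have "card ((*) a ` S) \<le> \<omega>"
      unfolding assms(10) by (rule clique_card_le_clique_number)
    then have "q ^ D \<le> \<omega>" using a S by (simp add: card_mult_image)
    have t\<kappa>: "real (dim V) \<le> \<kappa>"
    proof (cases "3 * dim V \<le> 2 * d")
      case True
      \<comment> \<open>\<open>2 / 3 \<le> 7 / 8\<close>, and the logarithmic term is nonnegative as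
        \<open>q \<ge> 2\<close>.\<close>
      then have "real (dim V) \<le> 7 / 8 * real d" by linarith
      moreover have "0 \<le> 7 / (32 * log 2 (real q))" using q2 by simp
      ultimately show ?thesis unfolding assms(12) kappa_def by linarith
    next
      case False
      then obtain h where "dim V \<le> h" "square_subfield_divisor q n U h"
        using dim_le_or_subfield_multiple[OF U V V0 VV] assms(4) q d by blast
      then have "dim V \<le> D" using le_D le_trans by blast
      then show ?thesis unfolding assms(12) kappa_def by simp
    qed
    have "real q ^ dim V = real q powr real (dim V)" using q2 by (simp add: powr_realpow)
    also have "\<dots> \<le> real q powr \<kappa>" using t\<kappa> q2 by (intro powr_mono) auto
    finally have "real \<omega> \<le> real q powr \<kappa> + real d" using rt \<omega>' by simp
    show "square_subfield_divisor q n U D" "1 \<le> D" "D \<le> d" "q ^ D \<le> \<omega>"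
      "real \<omega> \<le> real q powr \<kappa> + real d" by (fact | rule le_D[OF one])+
    show "\<exists>t r :: nat. \<omega> = q ^ t + r \<and> r + t \<le> d \<and> 1 \<le> t \<and> real t \<le> \<kappa>"
      using \<omega>' rt t1 t\<kappa> by blast
  qed
qed

end
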